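(* Let $(\mathbb{R}^d,\|\cdot\|)$ be a $d$-dimensional Minkowski space and let $T\subset\mathbb{R}^d$ be a $d$-simplex with a circumball $B$ and circumsphere $S=\partial B$ centered at $M$. Let $F$ be an arbitrary facet of $T$, let $A$ be the vertex of $T$ opposite to $F$, and let $E$ be the medial hyperplane between $F$ and $A$. Then the following are equivalent. (a) $M$ lies in the same open halfspace as $A$ with respect to $E$. (b) $M\notin \mathrm{cone}(\mathrm{aff}(F)\cap B,\,A):=\{A+\lambda(X-A) : X\in \mathrm{aff}(F)\cap B,\ \lambda\ge 0\}$.
   Context: A Minkowski space is $\mathbb{R}^d$ equipped with an arbitrary norm $\|\cdot\|$. For $r>0$, $B(X,r)=\{Y:\|Y-X\|\le r\}$ is the Minkowskian ball and $S(X,r)=\partial B(X,r)$ the Minkowskian sphere with center $X$ and radius $r$. A circumsphere of a $d$-simplex is a Minkowskian sphere containing all its vertices; the corresponding ball is a circumball and its center a circumcenter (circumcenters need not exist or be unique). The medial hyperplane between a facet $F$ of a $d$-simplex and the opposite vertex $A$ is the hyperplane bisecting every segment from $A$ to a point of $F$, i.e. $E=\tfrac12\left(A+\mathrm{aff}(F)\right)$. *)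

theory Defs
  imports "HOL-Analysis.Analysis"
begin

text \<open>
  A \<open>d\<close>-dimensional Minkowski space is the type \<open>real ^ 'n\<close>, with \<open>d = CARD('n)\<close>, together with
  an arbitrary norm \<open>N\<close>, which is unrelated to the built-in Euclidean \<open>norm\<close>.
\<close>

definition minkowski_norm :: "(real ^ 'n \<Rightarrow> real) \<Rightarrow> bool" where
  "minkowski_norm N \<longleftrightarrow>
     (\<forall>x. 0 \<le> N x) \<and>
     (\<forall>x. N x = 0 \<longleftrightarrow> x = 0) \<and>
     (\<forall>c x. N (c *\<^sub>R x) = \<bar>c\<bar> * N x) \<and>
     (\<forall>x y. N (x + y) \<le> N x + N y)"

definition minkowski_ball :: "(real ^ 'n \<Rightarrow> real) \<Rightarrow> real ^ 'n \<Rightarrow> real \<Rightarrow> (real ^ 'n) set" where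
  "minkowski_ball N X r = {Y. N (Y - X) \<le> r}"

text \<open>The Euclidean \<open>frontier\<close> is the one of \<open>N\<close>, as all norms on \<open>real ^ 'n\<close> induce the same topology.\<close>

definition minkowski_sphere :: "(real ^ 'n \<Rightarrow> real) \<Rightarrow> real ^ 'n \<Rightarrow> real \<Rightarrow> (real ^ 'n) set" where
  "minkowski_sphere N X r = frontier (minkowski_ball N X r)"

text \<open>
  The sphere with center \<open>M\<close> and radius \<open>r\<close> is a circumsphere of the simplex \<open>T\<close>,
  whose vertices are its extreme points.
\<close>

definition is_circumsphere :: "(real ^ 'n \<Rightarrow> real) \<Rightarrow> (real ^ 'n) set \<Rightarrow> real ^ 'n \<Rightarrow> real \<Rightarrow> bool" where
  "is_circumsphere N T M r \<longleftrightarrow> r > 0 \<and> {v. v extreme_point_of T} \<subseteq> minkowski_sphere N M r"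

definition medial_hyperplane :: "(real ^ 'n) set \<Rightarrow> real ^ 'n \<Rightarrow> (real ^ 'n) set" where
  "medial_hyperplane F A = {(1/2) *\<^sub>R (A + X) | X. X \<in> affine hull F}"

text \<open>
  Some open halfspace bounded by the hyperplane \<open>E\<close> contains both points; replacing \<open>(a, b)\<close> by
  \<open>(-a, -b)\<close> exchanges the two open halfspaces, so the inequality \<open><\<close> covers both.
\<close>

definition same_open_halfspace :: "(real ^ 'n) set \<Rightarrow> real ^ 'n \<Rightarrow> real ^ 'n \<Rightarrow> bool" where
  "same_open_halfspace E X Y \<longleftrightarrow>
     (\<exists>a b. a \<noteq> 0 \<and> E = {x. a \<bullet> x = b} \<and> X \<in> {x. a \<bullet> x < b} \<and> Y \<in> {x. a \<bullet> x < b})"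

definition cone_with_apex :: "(real ^ 'n) set \<Rightarrow> real ^ 'n \<Rightarrow> (real ^ 'n) set" where
  "cone_with_apex K A = {A + l *\<^sub>R (X - A) | X l. X \<in> K \<and> l \<ge> 0}"

end

theory Submission
  imports Defs
begin

text \<open>
  Choose an affine functional \<open>f\<close> with \<open>f A = 0\<close> and \<open>f = 1\<close> on \<open>aff(F)\<close>, so that the medial
  hyperplane is \<open>f = 1/2\<close> and (a) says \<open>f M < 1/2\<close>. A representation \<open>M = A + \<lambda>(X - A)\<close> with
  \<open>f X = 1\<close> forces \<open>\<lambda> = f M\<close>, and then \<open>X - M = (1/\<lambda> - 1)(M - A)\<close>. As \<open>M - A\<close> has norm \<open>r\<close>,
  \<open>X\<close> lies in the circumball iff \<open>\<bar>1/\<lambda> - 1\<bar> \<le> 1\<close>, that is, iff \<open>\<lambda> \<ge> 1/2\<close>.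
\<close>

text \<open>Homogeneity and the triangle inequality make \<open>N\<close> convex, and a convex
  function on a finite-dimensional space is continuous. This links \<open>N\<close> to the Euclidean
  topology, in which \<open>frontier\<close> is taken.\<close>

lemma minkowski_norm_continuous:
  fixes N :: "real ^ 'n \<Rightarrow> real"
  assumes "minkowski_norm N"
  shows "continuous_on UNIV N"
proof (rule convex_on_continuous)
  show "convex_on UNIV N"
  proof (rule convex_onI)
    fix t :: real and x y :: "real ^ 'n"
    assume "0 < t" "t < 1"
    moreover have "N ((1 - t) *\<^sub>R x + t *\<^sub>R y) \<le> N ((1 - t) *\<^sub>R x) + N (t *\<^sub>R y)"
      using assms unfolding minkowski_norm_def by blast
    ultimately show "N ((1 - t) *\<^sub>R x + t *\<^sub>R y) \<le> (1 - t) * N x + t * N y"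
      using assms by (simp add: minkowski_norm_def)
  qed simp
qed simp

text \<open>By continuity of \<open>N\<close> the ball is closed and the strict sublevel set is
  open, hence interior to the ball; what remains for the frontier is the level set.\<close>

lemma minkowski_sphere_subset:
  assumes "minkowski_norm N"
  shows "minkowski_sphere N X r \<subseteq> {Y. N (Y - X) = r}"
proof -
  have cont: "continuous_on UNIV (\<lambda>Y. N (Y - X))"
    by (intro continuous_on_compose2[OF minkowski_norm_continuous[OF assms]] continuous_intros) auto
  have "closed (minkowski_ball N X r)"
    unfolding minkowski_ball_def by (intro closed_Collect_le cont continuous_intros)
  moreover have "{Y. N (Y - X) < r} \<subseteq> interior (minkowski_ball N X r)"
    by (intro interior_maximal open_Collect_less cont continuous_intros)
      (auto simp: minkowski_ball_def)
  ultimately show ?thesis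
    by (force simp: minkowski_sphere_def frontier_def minkowski_ball_def)
qed

text \<open>A facet has dimension \<open>d - 1\<close>, so its affine hull is a hyperplane. It
  misses \<open>A\<close> because a face is the intersection of its affine hull with
  \<open>T\<close>; hence its equation can be normalised by the value at \<open>A\<close>.\<close>

lemma facet_of_simplex_affine_functional:
  fixes T :: "(real ^ 'n) set"
  assumes "int CARD('n) simplex T" and "F facet_of T" and "A \<in> T" and "A \<notin> F"
  obtains a where "a \<noteq> 0" and "affine hull F = {x. a \<bullet> (x - A) = 1}"
proof -
  have "aff_dim F = int (DIM(real ^ 'n) - 1)"
    using assms(2) aff_dim_simplex[OF assms(1)] by (simp add: facet_of_def of_nat_diff Suc_leI)
  then obtain a b where ab: "a \<noteq> 0" "affine hull F = {x. a \<bullet> x = b}"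
    unfolding aff_dim_eq_hyperplane by blast
  have "F = affine hull F \<inter> T"
    using face_of_imp_eq_affine_Int[OF convex_simplex[OF assms(1)] facet_of_imp_face_of[OF assms(2)]] .
  then have "A \<notin> affine hull F"
    using assms(3,4) by blast
  then have ne: "b - a \<bullet> A \<noteq> 0"
    by (simp add: ab)
  show thesis
  proof
    show "(1 / (b - a \<bullet> A)) *\<^sub>R a \<noteq> 0"
      using ab ne by simp
    show "affine hull F = {x. ((1 / (b - a \<bullet> A)) *\<^sub>R a) \<bullet> (x - A) = 1}"
      using ab ne by (auto simp: inner_diff_right divide_simps)
  qed
qed

lemma medial_hyperplane_eq:
  assumes "affine hull F = {x. a \<bullet> (x - A) = 1}"
  shows "medial_hyperplane F A = {x. a \<bullet> (x - A) = 1 / 2}"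
proof -
  have "x \<in> medial_hyperplane F A \<longleftrightarrow> a \<bullet> (x - A) = 1 / 2" for x
  proof
    assume "x \<in> medial_hyperplane F A"
    then show "a \<bullet> (x - A) = 1 / 2"
      by (auto simp: medial_hyperplane_def assms inner_simps field_simps)
  next
    assume "a \<bullet> (x - A) = 1 / 2"
    \<comment> \<open>This point is the preimage of \<open>x\<close> under the homothety with center
      \<open>A\<close> and ratio \<open>1 / 2\<close>.\<close>
    then have "2 *\<^sub>R x - A \<in> affine hull F"
      by (simp add: assms inner_simps)
    moreover have "x = (1 / 2) *\<^sub>R (A + (2 *\<^sub>R x - A))"
      by (simp add: scaleR_right_diff_distrib)
    ultimately show "x \<in> medial_hyperplane F A"
      unfolding medial_hyperplane_def by blast
  qed
  then show ?thesis by blast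
qed

text \<open>The definition allows any equation of the hyperplane. Convexity of the open halfspace
  avoids comparing two equations: if the claim failed, the segment from \<open>A\<close> to
  \<open>M\<close> would meet the hyperplane.\<close>

lemma same_open_halfspace_iff:
  assumes "a \<noteq> 0" and "0 < h"
  shows "same_open_halfspace {x. a \<bullet> (x - A) = h} M A \<longleftrightarrow> a \<bullet> (M - A) < h"
proof
  assume "same_open_halfspace {x. a \<bullet> (x - A) = h} M A"
  then obtain a' b' where E: "{x. a \<bullet> (x - A) = h} = {x. a' \<bullet> x = b'}"
    and lt: "M \<in> {x. a' \<bullet> x < b'}" "A \<in> {x. a' \<bullet> x < b'}"
    unfolding same_open_halfspace_def by blast
  show "a \<bullet> (M - A) < h"
  proof (rule ccontr)
    assume "\<not> a \<bullet> (M - A) < h"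
    define t where "t = h / (a \<bullet> (M - A))"
    have t: "0 \<le> t" "t \<le> 1" "t * (a \<bullet> (M - A)) = h"
      using \<open>\<not> a \<bullet> (M - A) < h\<close> \<open>0 < h\<close> by (auto simp: t_def)
    \<comment> \<open>the point where the segment from \<open>A\<close> to \<open>M\<close> meets the hyperplane\<close>
    let ?P = "(1 - t) *\<^sub>R A + t *\<^sub>R M"
    have "?P - A = t *\<^sub>R (M - A)"
      by (simp add: algebra_simps)
    with t have "?P \<in> {x. a \<bullet> (x - A) = h}"
      by simp
    then have "a' \<bullet> ?P = b'"
      unfolding E by blast
    moreover have "?P \<in> {x. a' \<bullet> x < b'}"
      using convexD_alt[OF convex_halfspace_lt lt(2,1) t(1,2)] .
    ultimately show False by simp
  qed
next
  assume "a \<bullet> (M - A) < h"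
  with assms show "same_open_halfspace {x. a \<bullet> (x - A) = h} M A"
    unfolding same_open_halfspace_def
    by (intro exI[of _ a] exI[of _ "h + a \<bullet> A"]) (auto simp: inner_diff_right)
qed

lemma mem_cone_with_apex_iff:
  assumes N: "minkowski_norm N" and r: "N (A - M) = r" "0 < r"
  shows "M \<in> cone_with_apex ({x. a \<bullet> (x - A) = 1} \<inter> minkowski_ball N M r) A
    \<longleftrightarrow> 1 / 2 \<le> a \<bullet> (M - A)"
proof -
  have scale: "N (c *\<^sub>R x) = \<bar>c\<bar> * N x" for c x
    using N by (simp add: minkowski_norm_def)
  show ?thesis
  proof
    assume "M \<in> cone_with_apex ({x. a \<bullet> (x - A) = 1} \<inter> minkowski_ball N M r) A"
    then obtain X l where X: "a \<bullet> (X - A) = 1" "N (X - M) \<le> r" and l: "0 \<le> l"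
      and M: "M = A + l *\<^sub>R (X - A)"
      by (auto simp: cone_with_apex_def minkowski_ball_def)
    have "N (A - M) = l * N (X - A)"
      using l scale[of "- l" "X - A"] by (simp add: M)
    moreover have "X - M = (1 - l) *\<^sub>R (X - A)"
      by (simp add: M algebra_simps)
    then have "N (X - M) = \<bar>1 - l\<bar> * N (X - A)"
      by (simp add: scale)
    \<comment> \<open>Both distances are multiples of \<open>N (X - A)\<close>, which is positive
      since \<open>r\<close> is, and so cancels.\<close>
    ultimately have "\<bar>1 - l\<bar> * N (X - A) \<le> l * N (X - A)" "0 < l * N (X - A)"
      using X r by simp_all
    then have "\<bar>1 - l\<bar> \<le> l"
      using l by (auto simp: zero_less_mult_iff)
    then show "1 / 2 \<le> a \<bullet> (M - A)"
      using X by (simp add: M)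
  next
    assume ge: "1 / 2 \<le> a \<bullet> (M - A)"
    \<comment> \<open>This is the only possible factor; \<open>X\<close> is where the ray from
      \<open>A\<close> through \<open>M\<close> meets the hyperplane at height
      \<open>1\<close>.\<close>
    define l where "l = a \<bullet> (M - A)"
    define X where "X = A + (1 / l) *\<^sub>R (M - A)"
    have l: "1 / 2 \<le> l" using ge l_def by simp
    have "a \<bullet> (X - A) = 1"
      using l by (simp add: X_def flip: l_def)
    moreover have "M = A + l *\<^sub>R (X - A)"
      using l by (simp add: X_def)
    moreover have "X - M = (1 - 1 / l) *\<^sub>R (A - M)"
      by (simp add: X_def algebra_simps)
    then have "N (X - M) = \<bar>1 - 1 / l\<bar> * r"
      by (simp add: scale r)
    \<comment> \<open>The bound \<open>1 / 2\<close> on \<open>l\<close> enters here, as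
      \<open>0 < 1 / l \<le> 2\<close>.\<close>
    moreover have "\<bar>1 - 1 / l\<bar> \<le> 1"
      using l by (simp add: abs_le_iff field_simps)
    then have "\<bar>1 - 1 / l\<bar> * r \<le> r"
      using r(2) by simp
    ultimately show "M \<in> cone_with_apex ({x. a \<bullet> (x - A) = 1} \<inter> minkowski_ball N M r) A"
      using l by (force simp: cone_with_apex_def minkowski_ball_def)
  qed
qed

theorem theorem2p1:
  fixes N :: "real ^ 'n \<Rightarrow> real"
    and T F :: "(real ^ 'n) set"
    and M A :: "real ^ 'n"
    and r :: real
  assumes "minkowski_norm N"
    and "int CARD('n) simplex T"
    and "is_circumsphere N T M r"
    and "F facet_of T"
    and "A extreme_point_of T" and "A \<notin> F"
  shows "same_open_halfspace (medial_hyperplane F A) M A \<longleftrightarrow>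
         M \<notin> cone_with_apex (affine hull F \<inter> minkowski_ball N M r) A"
proof -
  have "A \<in> T"
    using assms(5) by (simp add: extreme_point_of_def)
  then obtain a where a: "a \<noteq> 0" "affine hull F = {x. a \<bullet> (x - A) = 1}"
    using facet_of_simplex_affine_functional assms(2,4,6) by blast
  have "N (A - M) = r" "0 < r"
    using assms(3,5) minkowski_sphere_subset[OF assms(1)] by (auto simp: is_circumsphere_def)
  then show ?thesis
    using assms(1) a unfolding a(2) medial_hyperplane_eq[OF a(2)]
    by (subst same_open_halfspace_iff) (auto simp: mem_cone_with_apex_iff)
qed

end
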